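(* Let $X$ be a rooted tree on $n$ nodes with binary labels, such that for each level $\ell$ all nodes on level $\ell$ have the same number $k_\ell$ of children. Let $k_{\max} := \max_\ell k_\ell$ and $k_{\min} := \min_\ell k_\ell$, where the minimum is over all levels except the last one (containing the leaves). If $q < \frac{c}{c+1}$ and $k_{\min} > c$ for some $c \in \mathbb{Z}^+$, then there exists a finite constant $C$, depending only on $c$ and $q$, such that in the TED deletion model with deletion probability $q$, $\exp(C k_{\max}\log_{k_{\min}} n)$ independent traces suffice to reconstruct the labels of $X$ with high probability (i.e., there is an estimator which, given the topology, $q$ and that many traces, outputs the labels of $X$ with probability tending to $1$ as $n\to\infty$).
   Context: Tree trace reconstruction: $X$ is a rooted tree of known topology whose non-root nodes carry unknown binary labels; the children of every node have a left-to-right order. The level of a node is its graph distance from the root. TED (Tree Edit Distance) deletion model with parameter $q$: each non-root node is deleted independently with probability $q$ (the root is never deleted); deletions are associative, and when a node $v$ is deleted, all of its children become children of the parent of $v$ (contracting the edge between $v$ and its parent, keeping the parent's label), taking the place of $v$ in the left-to-right order among the parent's children. The resulting labeled ordered rooted tree is a trace. The goal is to recover the labels of $X$ from independent traces, knowing the deletion model, $q$, and the topology of $X$. *)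

theory Defs
  imports "HOL-Probability.Probability"
begin

text \<open>Finite ordered rooted trees; every node except the root carries a label.\<close>

datatype 'a node = Node (label: 'a) (subs: "'a node list")

datatype 'a rtree = Root (kids: "'a node list")

text \<open>
  A node is addressed by the list of child positions (counted from 0, left to right) on the path
  from the root to it. The root has address \<open>[]\<close>, and the level of a node is the length of its
  address.
\<close>

fun children_at :: "'a node list \<Rightarrow> nat list \<Rightarrow> 'a node list option" where
  "children_at ts [] = Some ts"
| "children_at ts (i # v) = (if i < length ts then children_at (subs (ts ! i)) v else None)"

definition nodes :: "'a rtree \<Rightarrow> nat list set" where
  "nodes X = {v. children_at (kids X) v \<noteq> None}"

definition num_children :: "'a rtree \<Rightarrow> nat list \<Rightarrow> nat" where
  "num_children X v = length (the (children_at (kids X) v))"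

definition last_level :: "'a rtree \<Rightarrow> nat" where
  "last_level X = Max (length ` nodes X)"

definition level_regular :: "'a rtree \<Rightarrow> (nat \<Rightarrow> nat) \<Rightarrow> bool" where
  "level_regular X k \<longleftrightarrow> (\<forall>v\<in>nodes X. num_children X v = k (length v))"

definition k_max :: "'a rtree \<Rightarrow> (nat \<Rightarrow> nat) \<Rightarrow> nat" where
  "k_max X k = Max (k ` {..last_level X})"

definition k_min :: "'a rtree \<Rightarrow> (nat \<Rightarrow> nat) \<Rightarrow> nat" where
  "k_min X k = Min (k ` {..<last_level X})"

definition tree_topology :: "'a rtree \<Rightarrow> unit rtree" where
  "tree_topology X = map_rtree (\<lambda>_. ()) X"

text \<open>
  \<open>D v\<close> says that the node with address \<open>v\<close> (in the original tree) is deleted.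
  \<open>contract_node D v t\<close> is the ordered list of trees that takes the place of the subtree \<open>t\<close> at
  address \<open>v\<close> in the child list of its parent, after all deletions within that subtree.
  In \<open>contract_kids D v i ts\<close> the list \<open>ts\<close> consists of the children of \<open>v\<close> from position \<open>i\<close> on.
\<close>

fun contract_node :: "(nat list \<Rightarrow> bool) \<Rightarrow> nat list \<Rightarrow> 'a node \<Rightarrow> 'a node list"
  and contract_kids :: "(nat list \<Rightarrow> bool) \<Rightarrow> nat list \<Rightarrow> nat \<Rightarrow> 'a node list \<Rightarrow> 'a node list"
where
  "contract_node D v (Node a ts) =
     (if D v then contract_kids D v 0 ts else [Node a (contract_kids D v 0 ts)])"
| "contract_kids D v i [] = []"
| "contract_kids D v i (t # ts) = contract_node D (v @ [i]) t @ contract_kids D v (Suc i) ts"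

definition ted_delete :: "(nat list \<Rightarrow> bool) \<Rightarrow> 'a rtree \<Rightarrow> 'a rtree" where
  "ted_delete D X = Root (contract_kids D [] 0 (kids X))"

definition ted_trace :: "real \<Rightarrow> 'a rtree \<Rightarrow> 'a rtree pmf" where
  "ted_trace q X =
     map_pmf (\<lambda>D. ted_delete D X) (Pi_pmf (nodes X - {[]}) False (\<lambda>_. bernoulli_pmf q))"

definition ted_traces :: "real \<Rightarrow> nat \<Rightarrow> 'a rtree \<Rightarrow> 'a rtree list pmf" where
  "ted_traces q T X = replicate_pmf T (ted_trace q X)"

text \<open>Finiteness matters: \<open>card\<close>, \<open>Max\<close> and \<open>Pi_pmf\<close> above are meaningful only for finite sets.\<close>

lemma finite_children_at: "finite {v. children_at ts v \<noteq> None}"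
proof (induction "size_list size ts" arbitrary: ts rule: less_induct)
  case less
  have "{v. children_at ts v \<noteq> None} \<subseteq>
    insert [] (\<Union>i<length ts. (#) i ` {v. children_at (subs (ts ! i)) v \<noteq> None})"
  proof
    fix v assume "v \<in> {v. children_at ts v \<noteq> None}"
    then show "v \<in> insert [] (\<Union>i<length ts. (#) i ` {v. children_at (subs (ts ! i)) v \<noteq> None})"
      by (cases v) (auto split: if_splits)
  qed
  moreover have "finite {v. children_at (subs (ts ! i)) v \<noteq> None}" if "i < length ts" for i
  proof (rule less)
    have "size_list size (subs (ts ! i)) < size (ts ! i)" by (cases "ts ! i") simp
    also have "\<dots> \<le> size_list size ts" using that by (intro size_list_estimation'[of "ts ! i"]) auto
    finally show "size_list size (subs (ts ! i)) < size_list size ts" .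
  qed
  ultimately show ?case by (elim finite_subset) auto
qed

lemma finite_nodes: "finite (nodes X)"
  unfolding nodes_def by (rule finite_children_at)

end

theory Submission
  imports Defs
begin

text \<open>
  Let \<open>d\<close> be the last level. Contraction never increases heights, so a child of the root of a
  trace that starts a downward path of \<open>d\<close> nodes must be an undeleted node of level 1 of the
  original tree. If the root of the trace has \<open>k\<^sub>0\<close> such children, then they are all the nodes of
  level 1, in their original order, and one can descend into any of them in the same way. Hence a
  trace in which this succeeds along the address \<open>v\<close> reveals the label of \<open>v\<close> without error, and
  once every address is revealed by some trace, \<open>X\<close> is the only tree of its topology that is
  consistent with all traces.

  Since \<open>(1 - q) (c + 1) > 1\<close>, the surviving descendants form a supercritical branching process: a
  node survives together with some path to the last level with probability at least a constant
  \<open>\<gamma> > 0\<close>. So a trace reveals the label of \<open>v\<close> with probability at least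
  \<open>\<gamma> ^ (1 + k\<^sub>0 + \<dots> + k\<^bsub>d-1\<^esub>) = exp (- O(k\<^sub>m\<^sub>a\<^sub>x d))\<close>, where \<open>d \<le> log\<^bsub>kmin\<^esub> n\<close>, and a union bound
  over the addresses concludes.
\<close>

section \<open>Regular forests\<close>

fun regular_forest :: "nat list \<Rightarrow> 'a node list \<Rightarrow> bool" where
  "regular_forest [] ts \<longleftrightarrow> ts = []"
| "regular_forest (k # ks) ts \<longleftrightarrow> length ts = k \<and> (\<forall>t\<in>set ts. regular_forest ks (subs t))"

fun address :: "nat list \<Rightarrow> nat list \<Rightarrow> bool" where
  "address ks [] \<longleftrightarrow> True"
| "address [] (i # v) \<longleftrightarrow> False"
| "address (k # ks) (i # v) \<longleftrightarrow> i < k \<and> address ks v"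

lemmas address_induct = address.induct [case_names root leaf child]

fun label_at :: "'a node list \<Rightarrow> nat list \<Rightarrow> 'a option" where
  "label_at ts [] = None"
| "label_at ts (i # v) =
     (if i < length ts
      then if v = [] then Some (label (ts ! i)) else label_at (subs (ts ! i)) v
      else None)"

lemma children_at_iff_address:
  "regular_forest ks ts \<Longrightarrow> children_at ts v \<noteq> None \<longleftrightarrow> address ks v"
proof (induction ks v arbitrary: ts rule: address_induct)
  case (child k ks i v)
  then show ?case by (auto simp: all_set_conv_all_nth)
qed auto

lemma regular_forest_map_node:
  "regular_forest ks (map (map_node f) ts) \<longleftrightarrow> regular_forest ks ts"
  by (induction ks arbitrary: ts) (auto simp: node.map_sel)

lemma regular_forest_eqI:
  assumes "regular_forest ks ts" "regular_forest ks us"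
    and "\<And>v. v \<noteq> [] \<Longrightarrow> address ks v \<Longrightarrow> label_at ts v = label_at us v"
  shows "ts = us"
  using assms
proof (induction ks arbitrary: ts us)
  case (Cons k ks)
  have "ts ! i = us ! i" if i: "i < k" for i
  proof (rule node.expand, intro conjI)
    show "label (ts ! i) = label (us ! i)"
      using Cons.prems i Cons.prems(3)[of "[i]"] by simp
    show "subs (ts ! i) = subs (us ! i)"
    proof (rule Cons.IH)
      show "regular_forest ks (subs (ts ! i))" "regular_forest ks (subs (us ! i))"
        using Cons.prems i by auto
      show "label_at (subs (ts ! i)) v = label_at (subs (us ! i)) v"
        if "v \<noteq> []" "address ks v" for v
        using Cons.prems(3)[of "i # v"] Cons.prems(1,2) that i by simp
    qed
  qed
  then show ?case using Cons.prems by (auto intro: nth_equalityI)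
qed auto

lemma prod_list_le_card_children_at:
  "regular_forest ks ts \<Longrightarrow> prod_list ks \<le> card {v. children_at ts v \<noteq> None}"
proof (induction ks arbitrary: ts)
  case Nil
  have "children_at ts [] \<noteq> None" by simp
  then have "card {v. children_at ts v \<noteq> None} > 0"
    using finite_children_at[of ts] by (simp only: card_gt_0_iff) blast
  then show ?case by simp
next
  case (Cons k ks)
  let ?N = "\<lambda>i. {v. children_at (subs (ts ! i)) v \<noteq> None}"
  have "prod_list (k # ks) = (\<Sum>i<k. prod_list ks)" by simp
  also have "\<dots> \<le> (\<Sum>i<k. card ((#) i ` ?N i))"
    using Cons by (intro sum_mono) (auto simp: card_image)
  also have "\<dots> = card (\<Union>i<k. (#) i ` ?N i)"
    by (rule card_UN_disjoint[symmetric]) (use finite_children_at in blast)+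
  also have "\<dots> \<le> card {v. children_at ts v \<noteq> None}"
    using Cons.prems by (intro card_mono finite_children_at) auto
  finally show ?case .
qed

section \<open>Reading labels off a trace\<close>

primrec has_depth :: "nat \<Rightarrow> 'a node \<Rightarrow> bool" where
  "has_depth 0 t \<longleftrightarrow> True"
| "has_depth (Suc h) t \<longleftrightarrow> (\<exists>s\<in>set (subs t). has_depth h s)"

definition deep_nodes :: "nat \<Rightarrow> 'a node list \<Rightarrow> 'a node list" where
  "deep_nodes h ts = filter (has_depth h) ts"

fun read_label :: "nat list \<Rightarrow> nat list \<Rightarrow> 'a node list \<Rightarrow> 'a option" where
  "read_label ks [] ts = None"
| "read_label [] (i # v) ts = None"
| "read_label (k # ks) (i # v) ts =
     (let fs = deep_nodes (length ks) ts in
      if length fs = k \<and> i < k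
      then if v = [] then Some (label (fs ! i)) else read_label ks v (subs (fs ! i))
      else None)"

definition kept_node :: "(nat list \<Rightarrow> bool) \<Rightarrow> nat list \<Rightarrow> 'a node \<Rightarrow> 'a node" where
  "kept_node D u t = Node (label t) (contract_kids D u 0 (subs t))"

definition survives_deep :: "nat \<Rightarrow> (nat list \<Rightarrow> bool) \<Rightarrow> nat list \<Rightarrow> 'a node \<Rightarrow> bool" where
  "survives_deep h D u t \<longleftrightarrow> \<not> D u \<and> has_depth h (kept_node D u t)"

lemma label_kept_node [simp]: "label (kept_node D u t) = label t"
  and subs_kept_node [simp]: "subs (kept_node D u t) = contract_kids D u 0 (subs t)"
  by (simp_all add: kept_node_def)

lemma contract_node_eq:
  "contract_node D u t = (if D u then contract_kids D u 0 (subs t) else [kept_node D u t])"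
  by (cases t) (simp add: kept_node_def)

lemma contract_kids_eq_concat:
  "contract_kids D u i ts =
     concat (map (\<lambda>j. contract_node D (u @ [i + j]) (ts ! j)) [0..<length ts])"
proof (induction ts arbitrary: i)
  case (Cons t ts)
  have "[0..<length (t # ts)] = 0 # map Suc [0..<length ts]"
    by (simp only: map_Suc_upt list.size upt_conv_Cons) simp
  then show ?case by (simp add: Cons comp_def del: upt_Suc)
qed simp

lemma has_depth_SucD: "has_depth (Suc h) t \<Longrightarrow> has_depth h t"
  by (induction h arbitrary: t) auto

lemma not_has_depth_contract_kids:
  assumes "regular_forest ks ts" "s \<in> set (contract_kids D u i ts)"
  shows "\<not> has_depth (length ks) s"
  using assms
proof (induction ks arbitrary: ts u i s)
  case (Cons k ks)
  obtain j where j: "j < length ts" "s \<in> set (contract_node D (u @ [i + j]) (ts ! j))"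
    using Cons.prems(2) by (auto simp: contract_kids_eq_concat)
  have shallow: "\<not> has_depth (length ks) r"
    if "r \<in> set (contract_kids D (u @ [i + j]) 0 (subs (ts ! j)))" for r
    using Cons.prems(1) j(1) by (intro Cons.IH[OF _ that]) auto
  show ?case
  proof (cases "D (u @ [i + j])")
    case True
    then have "\<not> has_depth (length ks) s" using shallow j(2) by (simp add: contract_node_eq)
    then show ?thesis using has_depth_SucD by auto
  next
    case False
    then show ?thesis using shallow j(2) by (auto simp: contract_node_eq)
  qed
qed auto

lemma deep_nodes_contract_node:
  assumes "regular_forest ks (subs t)"
  shows "deep_nodes (length ks) (contract_node D u t) =
    (if survives_deep (length ks) D u t then [kept_node D u t] else [])"
  using not_has_depth_contract_kids[OF assms]
  by (auto simp: deep_nodes_def contract_node_eq survives_deep_def filter_empty_conv)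

lemma deep_nodes_contract_kids:
  assumes "regular_forest (k # ks) ts"
  shows "deep_nodes (length ks) (contract_kids D u 0 ts) =
    map (\<lambda>j. kept_node D (u @ [j]) (ts ! j))
      (filter (\<lambda>j. survives_deep (length ks) D (u @ [j]) (ts ! j)) [0..<k])"
proof -
  have "deep_nodes (length ks) (contract_kids D u 0 ts) =
      concat (map (\<lambda>j. deep_nodes (length ks) (contract_node D (u @ [j]) (ts ! j))) [0..<k])"
    using assms by (simp add: contract_kids_eq_concat deep_nodes_def filter_concat comp_def)
  also have "\<dots> = concat (map (\<lambda>j. if survives_deep (length ks) D (u @ [j]) (ts ! j)
      then [kept_node D (u @ [j]) (ts ! j)] else []) [0..<k])"
    using assms by (intro arg_cong[where f = concat] map_cong refl deep_nodes_contract_node) auto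
  also have "\<dots> = map (\<lambda>j. kept_node D (u @ [j]) (ts ! j))
      (filter (\<lambda>j. survives_deep (length ks) D (u @ [j]) (ts ! j)) [0..<k])"
    by (induction k) auto
  finally show ?thesis .
qed

lemma read_label_contract_kids:
  assumes "regular_forest (k # ks) ts"
  shows "read_label (k # ks) (i # v) (contract_kids D u 0 ts) =
    (if i < k \<and> (\<forall>j<k. survives_deep (length ks) D (u @ [j]) (ts ! j))
     then if v = [] then Some (label (ts ! i))
          else read_label ks v (contract_kids D (u @ [i]) 0 (subs (ts ! i)))
     else None)"
proof -
  let ?survives = "\<lambda>j. survives_deep (length ks) D (u @ [j]) (ts ! j)"
  have "length (filter ?survives [0..<k]) = k \<longleftrightarrow> (\<forall>j<k. ?survives j)"
    using length_filter_less[of _ "[0..<k]" ?survives] by (fastforce simp: filter_True)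
  moreover have "filter ?survives [0..<k] = [0..<k]" if "\<forall>j<k. ?survives j"
    using that by (simp add: filter_id_conv)
  ultimately show ?thesis by (auto simp: Let_def deep_nodes_contract_kids[OF assms])
qed

lemma read_label_sound:
  assumes "regular_forest ks ts" "read_label ks v (contract_kids D u 0 ts) = Some a"
  shows "label_at ts v = Some a"
  using assms
proof (induction ks v arbitrary: ts u rule: address_induct)
  case (child k ks i v)
  have "i < k"
    and "(if v = [] then Some (label (ts ! i))
      else read_label ks v (contract_kids D (u @ [i]) 0 (subs (ts ! i)))) = Some a"
    using child.prems(2) unfolding read_label_contract_kids[OF child.prems(1)]
    by (simp_all split: if_split_asm del: read_label.simps)
  then show ?case
    using child.IH[of "subs (ts ! i)" "u @ [i]"] child.prems(1) by (cases "v = []") auto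
qed auto

fun alive :: "(nat list \<Rightarrow> bool) \<Rightarrow> nat list \<Rightarrow> nat list \<Rightarrow> bool" where
  "alive D [] u \<longleftrightarrow> \<not> D u"
| "alive D (k # ks) u \<longleftrightarrow> \<not> D u \<and> (\<exists>j\<in>{..<k}. alive D ks (u @ [j]))"

text \<open>
  Descending into child \<open>i\<close> requires its siblings to be alive, that is, visible at the address \<open>[]\<close>.
\<close>

fun visible :: "(nat list \<Rightarrow> bool) \<Rightarrow> nat list \<Rightarrow> nat list \<Rightarrow> nat list \<Rightarrow> bool" where
  "visible D ks u [] \<longleftrightarrow> alive D ks u"
| "visible D [] u (i # v) \<longleftrightarrow> False"
| "visible D (k # ks) u (i # v) \<longleftrightarrow>
     \<not> D u \<and> (\<forall>j\<in>{..<k}. visible D ks (u @ [j]) (if j = i then v else []))"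

lemma visible_imp_alive: "visible D ks u v \<Longrightarrow> address ks v \<Longrightarrow> alive D ks u"
proof (induction ks v arbitrary: u rule: address_induct)
  case (child k ks i v)
  then have "visible D ks (u @ [i]) v" by (auto dest!: bspec[of _ _ i])
  then show ?case using child by auto
qed auto

lemma alive_imp_survives_deep:
  assumes "regular_forest ks (subs t)" "alive D ks u"
  shows "survives_deep (length ks) D u t"
  using assms
proof (induction ks arbitrary: t u)
  case (Cons k ks)
  obtain i where i: "i < k" "alive D ks (u @ [i])" and "\<not> D u" using Cons.prems(2) by auto
  let ?s = "kept_node D (u @ [i]) (subs t ! i)"
  have s: "survives_deep (length ks) D (u @ [i]) (subs t ! i)"
    using Cons.prems(1) i by (intro Cons.IH) auto
  then have "?s \<in> set (contract_kids D u 0 (subs t))"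
    using Cons.prems(1) i
    by (auto simp: contract_kids_eq_concat[of D u] contract_node_eq survives_deep_def
        intro!: bexI[of _ i])
  then show ?case using s \<open>\<not> D u\<close> by (auto simp: survives_deep_def)
qed (simp add: survives_deep_def)

lemma visible_imp_read_label:
  assumes "regular_forest ks ts" "visible D ks u v" "address ks v" "v \<noteq> []"
  shows "read_label ks v (contract_kids D u 0 ts) \<noteq> None"
  using assms
proof (induction ks v arbitrary: ts u rule: address_induct)
  case (child k ks i v)
  have addr: "i < k" "address ks v" using child.prems(3) by auto
  have vis: "visible D ks (u @ [j]) (if j = i then v else [])" if "j < k" for j
    using child.prems(2) that by auto
  have reg: "regular_forest ks (subs (ts ! j))" if "j < k" for j
    using child.prems(1) that by auto
  have "survives_deep (length ks) D (u @ [j]) (ts ! j)" if "j < k" for j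
    using addr(2) that
    by (intro alive_imp_survives_deep[OF reg] visible_imp_alive[OF vis]) auto
  then show ?case
    using child.IH[OF reg[OF addr(1)], of "u @ [i]"] vis[OF addr(1)] addr
    by (simp add: read_label_contract_kids[OF child.prems(1)] del: read_label.simps)
qed auto

section \<open>Independence under product distributions\<close>

definition depends_on :: "(('a \<Rightarrow> 'b) \<Rightarrow> 'c) \<Rightarrow> 'a set \<Rightarrow> bool" where
  "depends_on P A \<longleftrightarrow> (\<forall>f g. (\<forall>x\<in>A. f x = g x) \<longrightarrow> P f = P g)"

lemma depends_onD: "depends_on P A \<Longrightarrow> (\<And>x. x \<in> A \<Longrightarrow> f x = g x) \<Longrightarrow> P f = P g"
  unfolding depends_on_def by blast

lemma depends_on_mono: "depends_on P A \<Longrightarrow> A \<subseteq> B \<Longrightarrow> depends_on P B"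
  unfolding depends_on_def by blast

lemma depends_on_const: "depends_on (\<lambda>_. b) A"
  unfolding depends_on_def by blast

lemma depends_on_component: "x \<in> A \<Longrightarrow> depends_on (\<lambda>f. f x) A"
  unfolding depends_on_def by blast

lemma depends_on_not: "depends_on P A \<Longrightarrow> depends_on (\<lambda>f. \<not> P f) A"
  unfolding depends_on_def by blast

lemma depends_on_conj:
  "depends_on P A \<Longrightarrow> depends_on Q A \<Longrightarrow> depends_on (\<lambda>f. P f \<and> Q f) A"
  unfolding depends_on_def by blast

lemma depends_on_Ball:
  "(\<And>j. j \<in> J \<Longrightarrow> depends_on (P j) A) \<Longrightarrow> depends_on (\<lambda>f. \<forall>j\<in>J. P j f) A"
  unfolding depends_on_def by blast

lemma depends_on_Bex:
  "(\<And>j. j \<in> J \<Longrightarrow> depends_on (P j) A) \<Longrightarrow> depends_on (\<lambda>f. \<exists>j\<in>J. P j f) A"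
  unfolding depends_on_def by blast

lemma prob_pmf_not:
  "measure_pmf.prob p {x. \<not> P x} = 1 - measure_pmf.prob p {x. P x}"
  using measure_pmf.prob_neg[of p P] by simp

lemma prob_pair_pmf_Times:
  "measure_pmf.prob (pair_pmf M N) (A \<times> B) = measure_pmf.prob M A * measure_pmf.prob N B"
proof -
  have "measure_pmf.prob (pair_pmf M N) (A \<times> B) =
      measure_pmf.prob (pair_pmf M N) ((A \<inter> set_pmf M) \<times> (B \<inter> set_pmf N))"
    by (subst measure_Int_set_pmf[symmetric]) (auto intro!: arg_cong2[where f = measure])
  also have "\<dots> = measure_pmf.prob M (A \<inter> set_pmf M) * measure_pmf.prob N (B \<inter> set_pmf N)"
    by (intro measure_pmf_prob_product) auto
  finally show ?thesis by (simp add: measure_Int_set_pmf)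
qed

lemma prob_Pi_pmf_Int:
  assumes "finite S" "depends_on P A"
  shows "measure_pmf.prob (Pi_pmf (S \<inter> A) d p) {f. P f} = measure_pmf.prob (Pi_pmf S d p) {f. P f}"
proof -
  have "P (\<lambda>x. if x \<in> S \<inter> A then f x else d) = P f" if "f \<in> set_pmf (Pi_pmf S d p)" for f
    using that set_Pi_pmf_subset[OF assms(1), of d p] by (intro depends_onD[OF assms(2)]) auto
  then show ?thesis
    unfolding Pi_pmf_subset[OF assms(1) Int_lower1] measure_map_pmf
    by (intro measure_pmf.finite_measure_eq_AE) (auto simp: AE_measure_pmf_iff)
qed

lemma prob_Pi_pmf_conj:
  assumes S: "finite S" and P: "depends_on P A" and Q: "depends_on Q B" and disj: "A \<inter> B = {}"
  shows "measure_pmf.prob (Pi_pmf S d p) {f. P f \<and> Q f} =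
    measure_pmf.prob (Pi_pmf S d p) {f. P f} * measure_pmf.prob (Pi_pmf S d p) {f. Q f}"
proof -
  let ?M = "Pi_pmf (S \<inter> A) d p" and ?N = "Pi_pmf (S \<inter> - A) d p"
  let ?merge = "\<lambda>(f, g) x. if x \<in> S \<inter> A then f x else g x"
  have Q': "depends_on Q (- A)" using disj by (intro depends_on_mono[OF Q]) auto
  have "Pi_pmf S d p = map_pmf ?merge (pair_pmf ?M ?N)"
    using Pi_pmf_union[of "S \<inter> A" "S \<inter> - A" d p] S
    by (simp add: Int_Un_distrib[symmetric] Compl_partition disjoint_iff)
  then have "measure_pmf.prob (Pi_pmf S d p) {f. P f \<and> Q f} =
      measure_pmf.prob (pair_pmf ?M ?N) {fg. P (?merge fg) \<and> Q (?merge fg)}"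
    by (simp add: vimage_def)
  also have "\<dots> = measure_pmf.prob (pair_pmf ?M ?N) ({f. P f} \<times> {g. Q g})"
  proof (intro measure_pmf.finite_measure_eq_AE)
    have "P (?merge (f, g)) = P f" if "f \<in> set_pmf ?M" "g \<in> set_pmf ?N" for f g
      using that S set_Pi_pmf_subset[of "S \<inter> A" d p] set_Pi_pmf_subset[of "S \<inter> - A" d p]
      by (intro depends_onD[OF P]) auto
    moreover have "Q (?merge (f, g)) = Q g" for f g
      by (intro depends_onD[OF Q']) auto
    ultimately show "AE fg in pair_pmf ?M ?N.
        fg \<in> {fg. P (?merge fg) \<and> Q (?merge fg)} \<longleftrightarrow> fg \<in> {f. P f} \<times> {g. Q g}"
      by (auto simp: AE_measure_pmf_iff)
  qed auto
  also have "\<dots> =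
      measure_pmf.prob (Pi_pmf S d p) {f. P f} * measure_pmf.prob (Pi_pmf S d p) {f. Q f}"
    by (simp only: prob_pair_pmf_Times prob_Pi_pmf_Int[OF S P] prob_Pi_pmf_Int[OF S Q'])
  finally show ?thesis .
qed

lemma prob_Pi_pmf_Ball:
  assumes "finite S" "finite J" "\<And>j. j \<in> J \<Longrightarrow> depends_on (P j) (A j)" "disjoint_family_on A J"
  shows "measure_pmf.prob (Pi_pmf S d p) {f. \<forall>j\<in>J. P j f} =
    (\<Prod>j\<in>J. measure_pmf.prob (Pi_pmf S d p) {f. P j f})"
  using assms(2-)
proof (induction J rule: finite_induct)
  case (insert j J)
  have "depends_on (P i) (\<Union>j\<in>J. A j)" if "i \<in> J" for i
    by (rule depends_on_mono[OF insert.prems(1)]) (use that in auto)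
  then have "depends_on (\<lambda>f. \<forall>j\<in>J. P j f) (\<Union>j\<in>J. A j)"
    by (rule depends_on_Ball)
  moreover have "A j \<inter> (\<Union>j\<in>J. A j) = {}"
    using insert.prems(2) insert.hyps(2) by (fastforce simp: disjoint_family_on_def)
  moreover have "disjoint_family_on A J"
    using insert.prems(2) by (rule disjoint_family_on_mono[rotated]) auto
  ultimately show ?case
    using insert prob_Pi_pmf_conj[OF assms(1), of "P j" "A j"] by simp
qed simp

lemma prob_replicate_pmf_lists:
  "measure_pmf.prob (replicate_pmf T p) (lists A) = measure_pmf.prob p A ^ T"
proof (induction T)
  case (Suc T)
  have "replicate_pmf (Suc T) p = map_pmf (\<lambda>(x, xs). x # xs) (pair_pmf p (replicate_pmf T p))"
    by (simp add: pair_pmf_def map_bind_pmf)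
  then have "measure_pmf.prob (replicate_pmf (Suc T) p) (lists A) =
      measure_pmf.prob (pair_pmf p (replicate_pmf T p)) (A \<times> lists A)"
    by (auto simp del: replicate_pmf.simps intro!: arg_cong2[where f = measure])
  then show ?case by (simp add: prob_pair_pmf_Times Suc del: replicate_pmf.simps)
qed simp

section \<open>Survival of random deletions\<close>

definition subtree :: "nat list \<Rightarrow> nat list set" where
  "subtree u = range ((@) u)"

lemma subtree_self: "u \<in> subtree u"
  by (auto simp: subtree_def image_iff intro: exI[of _ "[]"])

lemma subtree_child_subset: "subtree (u @ [i]) \<subseteq> subtree u - {u}"
  by (auto simp: subtree_def)

lemma disjoint_family_on_subtree_children: "disjoint_family_on (\<lambda>i. subtree (u @ [i])) I"
  by (auto simp: subtree_def disjoint_family_on_def)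

lemma depends_on_child: "depends_on P (subtree (u @ [i])) \<Longrightarrow> depends_on P (subtree u - {u})"
  by (rule depends_on_mono[OF _ subtree_child_subset])

lemma depends_on_root_conj:
  "depends_on Q (subtree u - {u}) \<Longrightarrow> depends_on (\<lambda>D. \<not> D u \<and> Q D) (subtree u)"
  by (intro depends_on_conj depends_on_not depends_on_component subtree_self)
     (rule depends_on_mono, auto)

lemma depends_on_alive: "depends_on (\<lambda>D. alive D ks u) (subtree u)"
proof (induction ks arbitrary: u)
  case Nil
  show ?case by (simp add: depends_on_not depends_on_component subtree_self)
next
  case (Cons k ks)
  show ?case
    unfolding alive.simps
    by (intro depends_on_root_conj depends_on_Bex depends_on_child[OF Cons.IH])
qed

lemma depends_on_visible: "depends_on (\<lambda>D. visible D ks u v) (subtree u)"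
proof (induction ks arbitrary: u v)
  case Nil
  show ?case
    by (cases v) (simp_all add: depends_on_alive depends_on_const del: alive.simps)
next
  case (Cons k ks)
  show ?case
  proof (cases v)
    case Nil
    then show ?thesis by (simp add: depends_on_alive del: alive.simps)
  next
    case v: (Cons i w)
    show ?thesis
      unfolding v visible.simps
      by (intro depends_on_root_conj depends_on_Ball depends_on_child[OF Cons.IH])
  qed
qed

text \<open>
  With \<open>k\<close> children per node, the probability \<open>s\<^sub>h\<close> that a node survives together with a path of
  \<open>h\<close> edges below it satisfies \<open>s\<^bsub>h+1\<^esub> = (1 - q) (1 - (1 - s\<^sub>h) ^ k)\<close>, so \<open>s\<^sub>h \<ge> \<gamma>\<close> for every
  subsolution \<open>\<gamma> \<le> s\<^sub>0 = 1 - q\<close>.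
\<close>

definition survival_subsolution :: "real \<Rightarrow> nat \<Rightarrow> real \<Rightarrow> bool" where
  "survival_subsolution q k \<gamma> \<longleftrightarrow> \<gamma> \<le> (1 - q) * (1 - (1 - \<gamma>) ^ k)"

lemma power_one_minus_le:
  fixes p :: real
  assumes "0 \<le> p" "p \<le> 1"
  shows "(1 - p) ^ n \<le> 1 / (1 + real n * p)"
proof -
  have "(1 - p) ^ n * (1 + real n * p) \<le> (1 - p) ^ n * (1 + p) ^ n"
    using assms Bernoulli_inequality[of p n] by (intro mult_left_mono) auto
  also have "\<dots> = (1 - p\<^sup>2) ^ n"
    by (simp add: power_mult_distrib[symmetric] power2_eq_square algebra_simps)
  also have "\<dots> \<le> 1"
    using assms by (intro power_le_one) (auto simp: power_le_one)
  finally show ?thesis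
    using assms by (simp add: pos_le_divide_eq add_pos_nonneg)
qed

text \<open>
  The witness \<open>\<gamma> = 1 - q - 1 / (c + 1)\<close> solves \<open>\<gamma> = (1 - q) (1 - 1 / (1 + (c + 1) \<gamma>))\<close>, where
  Bernoulli's inequality has replaced \<open>(1 - \<gamma>) ^ (c + 1)\<close> by its upper bound.
\<close>

lemma exists_survival_subsolution:
  assumes "0 \<le> q" "q < real c / (real c + 1)"
  obtains \<gamma> where "0 < \<gamma>" "\<gamma> \<le> 1 - q" "\<And>k. k > c \<Longrightarrow> survival_subsolution q k \<gamma>"
proof -
  define m where "m = real (Suc c)"
  define \<gamma> where "\<gamma> = 1 - q - 1 / m"
  have m: "1 / m > 0" "m > 0" "1 + m * \<gamma> = m * (1 - q)" by (simp_all add: m_def \<gamma>_def field_simps)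
  have "real c / (real c + 1) = 1 - 1 / m" by (simp add: m_def field_simps)
  then have \<gamma>: "0 < \<gamma>" "\<gamma> \<le> 1 - q" "\<gamma> \<le> 1" and q: "q < 1"
    using assms m(1) unfolding \<gamma>_def by linarith+
  show thesis
  proof
    fix k assume "k > c"
    have "(1 - \<gamma>) ^ k \<le> (1 - \<gamma>) ^ Suc c"
      using \<open>k > c\<close> \<gamma> by (intro power_decreasing) auto
    also have "\<dots> \<le> 1 / (m * (1 - q))"
      unfolding m(3)[symmetric] unfolding m_def by (rule power_one_minus_le) (use \<gamma> in auto)
    finally have "(1 - q) * (1 - (1 - \<gamma>) ^ k) \<ge> (1 - q) * (1 - 1 / (m * (1 - q)))"
      using q by (intro mult_left_mono) auto
    also have "(1 - q) * (1 - 1 / (m * (1 - q))) = \<gamma>"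
      using q m(2) by (simp add: \<gamma>_def field_simps)
    finally show "survival_subsolution q k \<gamma>" by (simp add: survival_subsolution_def)
  qed (use \<gamma> in auto)
qed

locale random_deletions =
  fixes q :: real and S :: "nat list set"
  assumes q: "0 \<le> q" "q \<le> 1" and finite_S: "finite S"
begin

abbreviation prob :: "((nat list \<Rightarrow> bool) \<Rightarrow> bool) \<Rightarrow> real" where
  "prob P \<equiv> measure_pmf.prob (Pi_pmf S False (\<lambda>_. bernoulli_pmf q)) {D. P D}"

lemma prob_not_deleted_ge: "1 - q \<le> prob (\<lambda>D. \<not> D u)"
proof -
  have "prob (\<lambda>D. \<not> D u) =
      measure_pmf.prob (map_pmf (\<lambda>D. D u) (Pi_pmf S False (\<lambda>_. bernoulli_pmf q))) {False}"
    by (simp add: vimage_def)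
  also have "\<dots> = (if u \<in> S then 1 - q else 1)"
    using q by (simp add: Pi_pmf_component finite_S measure_pmf_single)
  finally show ?thesis using q by simp
qed

lemma prob_root_conj_ge:
  assumes "depends_on Q (subtree u - {u})"
  shows "(1 - q) * prob Q \<le> prob (\<lambda>D. \<not> D u \<and> Q D)"
proof -
  have "(1 - q) * prob Q \<le> prob (\<lambda>D. \<not> D u) * prob Q"
    by (intro mult_right_mono prob_not_deleted_ge) simp
  also have "\<dots> = prob (\<lambda>D. \<not> D u \<and> Q D)"
    using prob_Pi_pmf_conj[OF finite_S depends_on_not[OF depends_on_component[of u "{u}"]] assms]
    by simp
  finally show ?thesis .
qed

lemma prob_all_children:
  assumes "\<And>i. depends_on (P i) (subtree (u @ [i]))"
  shows "prob (\<lambda>D. \<forall>i\<in>{..<k}. P i D) = (\<Prod>i<k. prob (P i))"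
  by (rule prob_Pi_pmf_Ball[OF finite_S finite_lessThan assms disjoint_family_on_subtree_children])

lemma prob_some_child_ge:
  assumes "\<And>i. depends_on (P i) (subtree (u @ [i]))" "\<And>i. \<gamma> \<le> prob (P i)"
  shows "1 - (1 - \<gamma>) ^ k \<le> prob (\<lambda>D. \<exists>i\<in>{..<k}. P i D)"
proof -
  have "prob (\<lambda>D. \<forall>i\<in>{..<k}. \<not> P i D) = (\<Prod>i<k. 1 - prob (P i))"
    using prob_all_children[OF depends_on_not[OF assms(1)]] by (simp add: prob_pmf_not)
  also have "\<dots> \<le> (\<Prod>i<k. 1 - \<gamma>)"
    using assms(2) by (intro prod_mono) auto
  finally show ?thesis
    using prob_pmf_not[of _ "\<lambda>D. \<exists>i\<in>{..<k}. P i D"] by simp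
qed

lemma prob_alive_ge:
  assumes "\<gamma> \<le> 1 - q" "\<And>k. k \<in> set ks \<Longrightarrow> survival_subsolution q k \<gamma>"
  shows "\<gamma> \<le> prob (\<lambda>D. alive D ks u)"
  using assms(2)
proof (induction ks arbitrary: u)
  case Nil
  show ?case using prob_not_deleted_ge[of u] assms(1) by simp
next
  case (Cons k ks)
  have "\<gamma> \<le> (1 - q) * (1 - (1 - \<gamma>) ^ k)"
    using Cons.prems by (simp add: survival_subsolution_def)
  also have "\<dots> \<le> (1 - q) * prob (\<lambda>D. \<exists>i\<in>{..<k}. alive D ks (u @ [i]))"
    using q Cons by (intro mult_left_mono prob_some_child_ge[where u = u] depends_on_alive) auto
  also have "\<dots> \<le> prob (\<lambda>D. alive D (k # ks) u)"
    unfolding alive.simps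
    by (intro prob_root_conj_ge depends_on_Bex depends_on_child[OF depends_on_alive])
  finally show ?case .
qed

lemma prob_visible_ge:
  assumes "0 \<le> \<gamma>" "\<gamma> \<le> 1 - q" "\<And>k. k \<in> set ks \<Longrightarrow> survival_subsolution q k \<gamma>" "address ks v"
  shows "\<gamma> ^ Suc (sum_list ks) \<le> prob (\<lambda>D. visible D ks u v)"
  using assms(3,4)
proof (induction ks v arbitrary: u rule: address_induct)
  case (root ks)
  have "\<gamma> ^ Suc (sum_list ks) \<le> \<gamma>"
    using assms(1,2) q power_le_one[of \<gamma> "sum_list ks"] by (simp add: mult_left_le)
  also have "\<dots> \<le> prob (\<lambda>D. alive D ks u)"
    by (rule prob_alive_ge[OF assms(2) root(1)])
  finally show ?case by simp
next
  case (child k ks i v)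
  let ?E = "\<lambda>j D. visible D ks (u @ [j]) (if j = i then v else [])"
  have "\<gamma> ^ (k + sum_list ks) = \<gamma> ^ Suc (sum_list ks) * (\<Prod>j\<in>{..<k} - {i}. \<gamma>)"
    using child.prems(2) by (cases k) (auto simp: power_add)
  also have "\<dots> = (\<Prod>j<k. if j = i then \<gamma> ^ Suc (sum_list ks) else \<gamma>)"
    using child.prems(2) by (simp add: prod.remove[of "{..<k}" i])
  also have "\<dots> \<le> (\<Prod>j<k. prob (?E j))"
    using child.IH child.prems prob_alive_ge[OF assms(2), of ks] assms(1)
    by (intro prod_mono) auto
  also have "\<dots> = prob (\<lambda>D. \<forall>j\<in>{..<k}. ?E j D)"
    by (rule prob_all_children[OF depends_on_visible, symmetric])
  finally have "\<gamma> * \<gamma> ^ (k + sum_list ks) \<le> (1 - q) * prob (\<lambda>D. \<forall>j\<in>{..<k}. ?E j D)"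
    using assms(1,2) by (intro mult_mono) auto
  also have "\<dots> \<le> prob (\<lambda>D. visible D (k # ks) u (i # v))"
    unfolding visible.simps
    by (intro prob_root_conj_ge depends_on_Ball depends_on_child[OF depends_on_visible])
  finally show ?case by simp
qed auto

end

section \<open>The consistent tree\<close>

definition consistent_tree :: "unit rtree \<Rightarrow> 'a rtree list \<Rightarrow> 'a rtree" where
  "consistent_tree U traces =
     (SOME Y. tree_topology Y = U \<and> (\<forall>t\<in>set traces. \<exists>D. t = ted_delete D Y))"

lemma regular_forest_tree_topology:
  "regular_forest ks (kids (tree_topology X)) \<longleftrightarrow> regular_forest ks (kids X)"
  by (simp add: tree_topology_def rtree.map_sel regular_forest_map_node)

lemma consistent_tree_eq:
  fixes X :: "'a rtree"
  assumes reg: "regular_forest ks (kids X)"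
    and traces: "\<forall>t\<in>set traces. \<exists>D. t = ted_delete D X"
    and read: "\<And>v. v \<noteq> [] \<Longrightarrow> address ks v \<Longrightarrow> \<exists>t\<in>set traces. read_label ks v (kids t) \<noteq> None"
  shows "consistent_tree (tree_topology X) traces = X"
  unfolding consistent_tree_def
proof (rule some_equality)
  show "tree_topology X = tree_topology X \<and> (\<forall>t\<in>set traces. \<exists>D. t = ted_delete D X)"
    using traces by simp
next
  fix Y assume Y: "tree_topology Y = tree_topology X \<and> (\<forall>t\<in>set traces. \<exists>D. t = ted_delete D Y)"
  then have regY: "regular_forest ks (kids Y)"
    using reg by (metis regular_forest_tree_topology)
  have "kids Y = kids X"
  proof (rule regular_forest_eqI[OF regY reg])
    fix v assume "v \<noteq> []" "address ks v"
    from read[OF this] obtain t a where t: "t \<in> set traces" "read_label ks v (kids t) = Some a"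
      by auto
    have "label_at (kids Z) v = Some a"
      if "regular_forest ks (kids Z)" "\<exists>D. t = ted_delete D Z" for Z :: "'a rtree"
      using that t(2) by (auto simp: ted_delete_def intro: read_label_sound)
    then show "label_at (kids Y) v = label_at (kids X) v"
      using reg regY Y traces t(1) by simp
  qed
  then show "Y = X" by (rule rtree.expand)
qed

lemma prob_read_label_None_le:
  assumes \<gamma>: "0 \<le> q" "0 \<le> \<gamma>" "\<gamma> \<le> 1 - q"
    and reg: "regular_forest ks (kids X)"
    and ks: "\<And>k. k \<in> set ks \<Longrightarrow> survival_subsolution q k \<gamma>"
    and v: "address ks v" "v \<noteq> []"
  shows "measure_pmf.prob (ted_trace q X) {t. read_label ks v (kids t) = None}
    \<le> 1 - \<gamma> ^ Suc (sum_list ks)"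
proof -
  interpret random_deletions q "nodes X - {[]}"
    using \<gamma> finite_nodes by unfold_locales auto
  have "\<gamma> ^ Suc (sum_list ks) \<le> prob (\<lambda>D. visible D ks [] v)"
    by (intro prob_visible_ge \<gamma> ks v)
  also have "\<dots> \<le> prob (\<lambda>D. read_label ks v (kids (ted_delete D X)) \<noteq> None)"
    using visible_imp_read_label[OF reg _ v]
    by (intro measure_pmf.finite_measure_mono) (auto simp: ted_delete_def)
  also have "\<dots> = measure_pmf.prob (ted_trace q X) {t. read_label ks v (kids t) \<noteq> None}"
    by (simp add: ted_trace_def vimage_def)
  finally show ?thesis by (simp only: prob_pmf_not)
qed

lemma consistent_tree_ne_imp_unread:
  assumes reg: "regular_forest ks (kids X)"
    and "traces \<in> set_pmf (ted_traces q T X)" "consistent_tree (tree_topology X) traces \<noteq> X"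
  shows "\<exists>v\<in>nodes X - {[]}. \<forall>t\<in>set traces. read_label ks v (kids t) = None"
proof (rule ccontr)
  assume "\<not> ?thesis"
  then have "\<exists>t\<in>set traces. read_label ks v (kids t) \<noteq> None" if "v \<noteq> []" "address ks v" for v
    using that children_at_iff_address[OF reg, of v] by (auto simp: nodes_def)
  moreover have "\<forall>t\<in>set traces. \<exists>D. t = ted_delete D X"
    using assms(2) by (auto simp: ted_traces_def ted_trace_def set_replicate_pmf)
  ultimately show False
    using consistent_tree_eq[OF reg] assms(3) by simp
qed

lemma prob_consistent_tree_ne_le:
  assumes \<gamma>: "0 \<le> q" "0 \<le> \<gamma>" "\<gamma> \<le> 1 - q"
    and reg: "regular_forest ks (kids X)"
    and ks: "\<And>k. k \<in> set ks \<Longrightarrow> survival_subsolution q k \<gamma>"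
  shows "measure_pmf.prob (ted_traces q T X) {traces. consistent_tree (tree_topology X) traces \<noteq> X}
    \<le> real (card (nodes X)) * (1 - \<gamma> ^ Suc (sum_list ks)) ^ T"
proof -
  let ?unread = "\<lambda>v. {t :: 'a rtree. read_label ks v (kids t) = None}"
  let ?wrong = "{traces. consistent_tree (tree_topology X) traces \<noteq> X}"
  let ?V = "nodes X - {[]}" and ?M = "ted_traces q T X" and ?r = "1 - \<gamma> ^ Suc (sum_list ks)"
  have "?wrong \<inter> set_pmf ?M \<subseteq> (\<Union>v\<in>?V. lists (?unread v))"
    by (auto dest!: consistent_tree_ne_imp_unread[OF reg])
  then have "measure_pmf.prob ?M (?wrong \<inter> set_pmf ?M)
      \<le> measure_pmf.prob ?M (\<Union>v\<in>?V. lists (?unread v))"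
    by (intro measure_pmf.finite_measure_mono) auto
  also have "\<dots> \<le> (\<Sum>v\<in>?V. measure_pmf.prob ?M (lists (?unread v)))"
    using finite_nodes by (intro measure_pmf.finite_measure_subadditive_finite) auto
  also have "\<dots> \<le> (\<Sum>v\<in>?V. ?r ^ T)"
    using prob_read_label_None_le[OF \<gamma> reg ks] children_at_iff_address[OF reg]
    by (intro sum_mono)
       (simp add: ted_traces_def prob_replicate_pmf_lists power_mono nodes_def del: power_Suc)
  also have "\<dots> \<le> real (card (nodes X)) * ?r ^ T"
  proof -
    have "0 \<le> ?r" using \<gamma> by (simp add: power_le_one del: power_Suc)
    then show ?thesis
      using finite_nodes[of X] by (simp add: mult_right_mono card_mono del: power_Suc)
  qed
  finally show ?thesis by (simp add: measure_Int_set_pmf)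
qed

section \<open>Level-regular trees\<close>

lemma regular_forest_of_levels:
  assumes "\<And>v us. children_at ts v = Some us \<Longrightarrow> length us = k (l + length v)"
    and "\<And>v. children_at ts v \<noteq> None \<Longrightarrow> l + length v \<le> d"
  shows "regular_forest (map k [l..<d]) ts"
  using assms
proof (induction "d - l" arbitrary: l ts)
  case 0
  have "children_at ts [] \<noteq> None" by simp
  then have "l = d" using "0.hyps" "0.prems"(2)[of "[]"] by auto
  then have "ts = []" using "0.prems"(2)[of "[0]"] by (cases ts) auto
  then show ?case using \<open>l = d\<close> by simp
next
  case (Suc m)
  have "length ts = k l" using Suc.prems(1)[of "[]"] by simp
  moreover have "regular_forest (map k [Suc l..<d]) (subs t)" if "t \<in> set ts" for t
  proof -
    obtain i where i: "i < length ts" "t = ts ! i"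
      using \<open>t \<in> set ts\<close> by (auto simp: in_set_conv_nth)
    show ?thesis
    proof (rule Suc.hyps)
      show "m = d - Suc l" using Suc.hyps(2) by simp
      show "length us = k (Suc l + length v)" if "children_at (subs t) v = Some us" for v us
        using Suc.prems(1)[of "i # v" us] that i by simp
      show "Suc l + length v \<le> d" if "children_at (subs t) v \<noteq> None" for v
        using Suc.prems(2)[of "i # v"] that i by simp
    qed
  qed
  moreover have "[l..<d] = l # [Suc l..<d]" using Suc.hyps(2) by (simp add: upt_conv_Cons)
  ultimately show ?case by simp
qed

lemma length_le_last_level: "v \<in> nodes X \<Longrightarrow> length v \<le> last_level X"
  unfolding last_level_def using finite_nodes by (intro Max_ge) auto

lemma last_level_pos:
  assumes "card (nodes X) \<ge> 2"
  shows "last_level X > 0"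
proof -
  have "\<not> nodes X \<subseteq> {[]}" using assms card_mono[of "{[]}" "nodes X"] by auto
  then obtain v where "v \<in> nodes X" "v \<noteq> []" by auto
  then show ?thesis using length_le_last_level[of v X] by (cases v) auto
qed

lemma k_min_le: "l < last_level X \<Longrightarrow> k_min X k \<le> k l"
  by (auto simp: k_min_def intro: Min_le)

lemma le_k_max: "l \<le> last_level X \<Longrightarrow> k l \<le> k_max X k"
  by (auto simp: k_max_def intro: Max_ge)

definition child_counts :: "'a rtree \<Rightarrow> (nat \<Rightarrow> nat) \<Rightarrow> nat list" where
  "child_counts X k = map k [0..<last_level X]"

lemma regular_forest_child_counts:
  assumes "level_regular X k"
  shows "regular_forest (child_counts X k) (kids X)"
  unfolding child_counts_def
proof (rule regular_forest_of_levels)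
  show "length us = k (0 + length v)" if "children_at (kids X) v = Some us" for v us
  proof -
    have "v \<in> nodes X" using that by (simp add: nodes_def)
    then show ?thesis using assms that by (auto simp: level_regular_def num_children_def)
  qed
  show "0 + length v \<le> last_level X" if "children_at (kids X) v \<noteq> None" for v
    using that length_le_last_level[of v X] by (simp add: nodes_def)
qed

lemma k_min_power_last_level_le:
  assumes "level_regular X k"
  shows "k_min X k ^ last_level X \<le> card (nodes X)"
proof -
  have "k_min X k ^ last_level X = (\<Prod>l=0..<last_level X. k_min X k)" by simp
  also have "\<dots> \<le> (\<Prod>l=0..<last_level X. k l)"
    by (intro prod_mono) (auto intro: k_min_le)
  also have "\<dots> = prod_list (child_counts X k)"
    by (simp add: child_counts_def prod.distinct_set_conv_list[symmetric])
  also have "\<dots> \<le> card (nodes X)"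
    unfolding nodes_def
    by (rule prod_list_le_card_children_at[OF regular_forest_child_counts[OF assms]])
  finally show ?thesis .
qed

lemma sum_list_child_counts_le: "sum_list (child_counts X k) \<le> k_max X k * last_level X"
proof -
  have "sum_list (child_counts X k) = (\<Sum>l=0..<last_level X. k l)"
    by (simp add: child_counts_def sum.distinct_set_conv_list[symmetric])
  also have "\<dots> \<le> k_max X k * last_level X"
    using sum_bounded_above[of "{0..<last_level X}" k "k_max X k"]
    by (simp add: le_k_max mult.commute)
  finally show ?thesis .
qed

locale level_regular_tree =
  fixes X :: "'a rtree" and k :: "nat \<Rightarrow> nat"
  assumes level_regular: "level_regular X k"
    and two_le_card: "2 \<le> card (nodes X)"
    and two_le_k_min: "2 \<le> k_min X k"
begin

definition trace_exponent :: real where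
  "trace_exponent = real (k_max X k) * log (real (k_min X k)) (real (card (nodes X)))"

lemma k_min_le_k_max: "k_min X k \<le> k_max X k"
  using last_level_pos[OF two_le_card] k_min_le[of 0 X k] le_k_max[of 0 X k] by simp

lemma last_level_le_log: "real (last_level X) \<le> log (real (k_min X k)) (real (card (nodes X)))"
proof -
  have "real (k_min X k) ^ last_level X \<le> real (card (nodes X))"
    using k_min_power_last_level_le[OF level_regular] by (metis of_nat_le_iff of_nat_power)
  then show ?thesis
    using two_le_card two_le_k_min by (subst le_log_iff) (auto simp: powr_realpow)
qed

lemma card_nodes_le_exp: "real (card (nodes X)) \<le> exp trace_exponent"
proof -
  have "ln (real (k_min X k)) \<le> real (k_max X k)"
    using ln_le_minus_one[of "real (k_min X k)"] two_le_k_min k_min_le_k_max by simp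
  then have "ln (real (card (nodes X))) * ln (real (k_min X k)) \<le>
      ln (real (card (nodes X))) * real (k_max X k)"
    using two_le_card by (intro mult_left_mono) auto
  then have "ln (real (card (nodes X))) \<le> trace_exponent"
    using two_le_k_min by (simp add: trace_exponent_def log_def field_simps)
  then have "exp (ln (real (card (nodes X)))) \<le> exp trace_exponent" by simp
  then show ?thesis using two_le_card by simp
qed

lemma Suc_sum_list_child_counts_le: "real (Suc (sum_list (child_counts X k))) \<le> 2 * trace_exponent"
proof -
  have "k_max X k * last_level X > 0"
    using last_level_pos[OF two_le_card] two_le_k_min k_min_le_k_max by simp
  then have "Suc (sum_list (child_counts X k)) \<le> 2 * (k_max X k * last_level X)"
    using sum_list_child_counts_le[of X k] by linarith
  then have "real (Suc (sum_list (child_counts X k))) \<le>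
      2 * (real (k_max X k) * real (last_level X))"
    by (metis of_nat_le_iff of_nat_mult of_nat_numeral)
  also have "\<dots> \<le> 2 * trace_exponent"
    unfolding trace_exponent_def by (intro mult_left_mono last_level_le_log) auto
  finally show ?thesis .
qed

lemma card_nodes_squared_le:
  fixes \<gamma> :: real
  assumes \<gamma>: "0 < \<gamma>" "\<gamma> \<le> 1" and T: "exp ((2 - 2 * ln \<gamma>) * trace_exponent) \<le> T"
  shows "(real (card (nodes X)))\<^sup>2 \<le> T * \<gamma> ^ Suc (sum_list (child_counts X k))"
proof -
  have "(real (card (nodes X)))\<^sup>2 \<le> (exp trace_exponent)\<^sup>2"
    by (intro power_mono card_nodes_le_exp) auto
  also have "\<dots> = exp ((2 - 2 * ln \<gamma>) * trace_exponent) * \<gamma> powr (2 * trace_exponent)"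
    using \<gamma> by (simp add: powr_def exp_double[symmetric] exp_add[symmetric] algebra_simps)
  also have "\<dots> \<le> T * \<gamma> powr real (Suc (sum_list (child_counts X k)))"
    using \<gamma> T order.trans[OF exp_ge_zero T]
    by (intro mult_mono powr_mono' Suc_sum_list_child_counts_le) auto
  also have "\<dots> = T * \<gamma> ^ Suc (sum_list (child_counts X k))"
    using \<gamma> by (simp only: powr_realpow)
  finally show ?thesis .
qed

lemma prob_consistent_tree_ge:
  fixes q \<gamma> :: real
  assumes q: "0 \<le> q" "0 < \<gamma>" "\<gamma> \<le> 1 - q"
    and subsolution: "\<And>l. k_min X k \<le> l \<Longrightarrow> survival_subsolution q l \<gamma>"
  defines "T \<equiv> nat \<lceil>exp ((2 - 2 * ln \<gamma>) * trace_exponent)\<rceil>"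
  shows "1 - 1 / real (card (nodes X)) \<le>
    measure_pmf.prob (ted_traces q T X) {traces. consistent_tree (tree_topology X) traces = X}"
proof -
  let ?n = "real (card (nodes X))" and ?p = "\<gamma> ^ Suc (sum_list (child_counts X k))"
  have n: "0 < ?n" using two_le_card by simp
  have p: "0 \<le> ?p" "?p \<le> 1" using q by (auto simp: power_le_one simp del: power_Suc)
  have "?n\<^sup>2 \<le> real T * ?p"
    unfolding T_def using q by (intro card_nodes_squared_le real_nat_ceiling_ge) auto
  then have square_le: "?n\<^sup>2 \<le> 1 + real T * ?p" by linarith
  have "measure_pmf.prob (ted_traces q T X) {traces. consistent_tree (tree_topology X) traces \<noteq> X}
      \<le> ?n * (1 - ?p) ^ T"
    using q subsolution k_min_le[of _ X k]
    by (intro prob_consistent_tree_ne_le regular_forest_child_counts level_regular)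
       (auto simp: child_counts_def)
  also have "\<dots> \<le> ?n * (1 / (1 + real T * ?p))"
    using n p by (intro mult_left_mono power_one_minus_le) auto
  also have "\<dots> \<le> ?n * (1 / ?n\<^sup>2)"
    using n square_le by (intro mult_left_mono frac_le) auto
  also have "\<dots> = 1 / ?n" using n by (simp add: power2_eq_square)
  finally show ?thesis by (simp add: prob_pmf_not)
qed

end

theorem theorem3:
  fixes c :: nat and q :: real
  assumes "c > 0" and "0 \<le> q" and "q < real c / (real c + 1)"
  shows "\<exists>(C :: real) (estimator :: unit rtree \<Rightarrow> bool rtree list \<Rightarrow> bool rtree).
    \<forall>\<epsilon>>0. \<forall>\<^sub>F n in sequentially.
      \<forall>(X :: bool rtree) (k :: nat \<Rightarrow> nat).
        card (nodes X) = n \<and> level_regular X k \<and> k_min X k > c \<longrightarrow>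
        measure_pmf.prob
          (ted_traces q (nat \<lceil>exp (C * real (k_max X k) * log (real (k_min X k)) (real n))\<rceil>) X)
          {traces. estimator (tree_topology X) traces = X} \<ge> 1 - \<epsilon>"
proof -
  obtain \<gamma> where \<gamma>: "0 < \<gamma>" "\<gamma> \<le> 1 - q" "\<And>k. k > c \<Longrightarrow> survival_subsolution q k \<gamma>"
    using exists_survival_subsolution assms(2,3) by blast
  define C where "C = 2 - 2 * ln \<gamma>"
  have recovery: "1 - \<epsilon> \<le> measure_pmf.prob
      (ted_traces q (nat \<lceil>exp (C * real (k_max X k) * log (real (k_min X k)) (real n))\<rceil>) X)
      {traces. consistent_tree (tree_topology X) traces = X}"
    if n: "2 \<le> n \<and> 1 / real n < \<epsilon>"
      and X: "card (nodes X) = n \<and> level_regular X k \<and> k_min X k > c"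
    for \<epsilon> n k and X :: "bool rtree"
  proof -
    interpret level_regular_tree X k using n X assms(1) by unfold_locales auto
    have "survival_subsolution q l \<gamma>" if "k_min X k \<le> l" for l using \<gamma>(3) X that by simp
    from prob_consistent_tree_ge[OF assms(2) \<gamma>(1,2) this] show ?thesis
      using n X by (simp add: C_def trace_exponent_def mult.assoc)
  qed
  have large: "\<forall>\<^sub>F n in sequentially. 2 \<le> n \<and> 1 / real n < \<epsilon>" if "\<epsilon> > 0" for \<epsilon>
    using that by (intro eventually_conj eventually_ge_at_top order_tendstoD(2)[OF lim_1_over_n])
  show ?thesis
    by (intro exI[of _ C] exI[of _ consistent_tree] allI impI eventually_mono[OF large] recovery)
qed

end
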